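(* Let $n,N\ge 1$ and let $L=(L_1,\dots,L_N)\in\mathcal H^N$ be such that $\ker(\nabla_L)$ contains only scalar multiples of the identity matrix. For $\rho_0,\rho_1\in\mathcal D$ define $$W_1(\rho_0,\rho_1):=\sup_{f\in\mathcal H}\left\{\operatorname{tr}[f(\rho_0-\rho_1)]\ \mid\ \|\nabla_L f\|\le 1\right\}.$$ Then $W_1$ is a metric on the space of density matrices $\mathcal D$.
   Context: All matrices are complex. $\mathcal H$ and $\mathcal S$ denote the sets of $n\times n$ Hermitian and skew-Hermitian matrices, respectively. $\mathcal H^N$ and $\mathcal S^N$ denote the spaces of block-column vectors with $N$ blocks in $\mathcal H$, respectively $\mathcal S$ (so such an element is an $nN\times n$ matrix). $\mathcal H_+\subset\mathcal H$ is the cone of positive semidefinite matrices and $\mathcal D=\{\rho\in\mathcal H_+\mid \operatorname{tr}(\rho)=1\}$ is the set of density matrices. For $L\in\mathcal H^N$, the gradient operator $\nabla_L:\mathcal H\to\mathcal S^N$ sends $X$ to the block-column with $k$-th block $L_kX-XL_k$. For a block-column, viewed as an $nN\times n$ matrix, $\|\cdot\|$ is the operator norm (largest singular value). *)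

theory Defs
  imports "HOL-Analysis.Analysis"
begin

definition conj_transpose :: "complex ^ 'n ^ 'm \<Rightarrow> complex ^ 'm ^ 'n" where
  "conj_transpose A = (\<chi> i j. cnj (A $ j $ i))"

definition hermitian_matrices :: "(complex ^ 'n ^ 'n) set" where
  "hermitian_matrices = {A. conj_transpose A = A}"

definition skew_hermitian_matrices :: "(complex ^ 'n ^ 'n) set" where
  "skew_hermitian_matrices = {A. conj_transpose A = - A}"

definition psd_matrices :: "(complex ^ 'n::finite ^ 'n) set" where
  "psd_matrices = {A \<in> hermitian_matrices.
     \<forall>x. (\<Sum>i\<in>UNIV. cnj (x $ i) * (A *v x) $ i) \<in> \<real>\<^sub>\<ge>\<^sub>0}"

definition density_matrices :: "(complex ^ 'n::finite ^ 'n) set" where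
  "density_matrices = {\<rho> \<in> psd_matrices. trace \<rho> = 1}"

(* A block column with N blocks of size n x n is a vector of matrices indexed by a type 'k
   with CARD('k) = N; stack views it as an nN x n matrix, with rows indexed by pairs
   (block, row inside the block). *)

definition stack :: "complex ^ 'n ^ 'm ^ 'k \<Rightarrow> complex ^ 'n ^ ('k \<times> 'm)" where
  "stack B = (\<chi> p. B $ fst p $ snd p)"

definition block_opnorm :: "complex ^ 'n::finite ^ 'm::finite ^ 'k::finite \<Rightarrow> real" where
  "block_opnorm B = onorm (\<lambda>x. stack B *v x)"

definition gradient ::
  "complex ^ 'n::finite ^ 'n ^ 'k::finite \<Rightarrow> complex ^ 'n ^ 'n \<Rightarrow> complex ^ 'n ^ 'n ^ 'k" where
  "gradient L X = (\<chi> k. L $ k ** X - X ** L $ k)"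

lemma conj_transpose_mult:
  fixes A :: "complex ^ 'n::finite ^ 'm" and B :: "complex ^ 'p ^ 'n"
  shows "conj_transpose (A ** B) = conj_transpose B ** conj_transpose A"
  by (simp add: conj_transpose_def matrix_matrix_mult_def vec_eq_iff mult.commute)

lemma conj_transpose_diff:
  "conj_transpose (A - B) = conj_transpose A - conj_transpose B"
  by (simp add: conj_transpose_def vec_eq_iff)

lemma gradient_skew_hermitian:
  assumes "\<forall>k. L $ k \<in> hermitian_matrices" and "X \<in> hermitian_matrices"
  shows "gradient L X $ k \<in> skew_hermitian_matrices"
  using assms
  by (simp add: gradient_def hermitian_matrices_def skew_hermitian_matrices_def
      conj_transpose_mult conj_transpose_diff)

lemma trace_mult_hermitian_real:
  assumes "A \<in> hermitian_matrices" and "B \<in> hermitian_matrices"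
  shows "trace (A ** B) \<in> \<real>"
proof -
  have "cnj (trace (A ** B)) = trace (conj_transpose (A ** B))"
    by (simp add: trace_def conj_transpose_def)
  also have "\<dots> = trace (B ** A)"
    using assms by (simp add: conj_transpose_mult hermitian_matrices_def)
  also have "\<dots> = trace (A ** B)"
    by (rule trace_mul_sym)
  finally show ?thesis
    by (simp add: Reals_cnj_iff)
qed

(* Re only changes the type, since the trace is real for Hermitian arguments
   (trace_mult_hermitian_real). The supremum is taken in the extended reals because a real
   Sup is unspecified on unbounded sets; finiteness is a separate claim. *)

definition W1 ::
  "complex ^ 'n::finite ^ 'n ^ 'k::finite \<Rightarrow> complex ^ 'n ^ 'n \<Rightarrow> complex ^ 'n ^ 'n \<Rightarrow> ereal" where
  "W1 L \<rho>\<^sub>0 \<rho>\<^sub>1 =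
     (SUP f \<in> {f \<in> hermitian_matrices. block_opnorm (gradient L f) \<le> 1}.
        ereal (Re (trace (f ** (\<rho>\<^sub>0 - \<rho>\<^sub>1)))))"

end

theory Submission imports Defs begin

text \<open>
  The only two axioms with content are that \<^term>\<open>W1 L\<close> is finite and that it separates points;
  nonnegativity, symmetry and the triangle inequality hold for every functional that is a supremum
  of linear functionals of \<open>\<rho>\<^sub>0 - \<rho>\<^sub>1\<close> over a symmetric set of potentials containing \<open>0\<close>.

  Finiteness is a Poincare inequality. The kernel of the gradient on Hermitian matrices consists of
  the scalars, so the gradient is injective on the traceless Hermitian matrices. On a
  finite-dimensional space injectivity is quantitative, so the norm of a traceless potential is
  bounded by a multiple of the norm of its gradient (\<open>gradient_poincare\<close>). Adding a scalar to a
  potential changes neither its gradient nor its pairing with a difference of two density matrices,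
  so every feasible potential may be assumed traceless. The feasible potentials then form a bounded
  set, and so do the values over which the supremum is taken.

  For separation, the Hermitian difference \<open>D = \<rho>\<^sub>0 - \<rho>\<^sub>1\<close> itself, scaled down until its gradient has
  operator norm at most \<open>1\<close>, is a feasible potential, and its pairing with \<open>D\<close> is a positive multiple
  of \<open>tr (D\<^sup>2)\<close>, the sum of the squared moduli of the entries of \<open>D\<close>.
\<close>

section \<open>The operator norm of a block column\<close>

lemma linear_matrix_vector_mult:
  fixes A :: "complex ^ 'n::finite ^ 'm::finite"
  shows "linear (\<lambda>x. A *v x)"
proof (rule linearI)
  show "A *v (x + y) = A *v x + A *v y" for x y
    by (rule matrix_vector_right_distrib)
  show "A *v (r *\<^sub>R x) = r *\<^sub>R (A *v x)" for r x
    by (simp add: vec_eq_iff matrix_vector_mult_def scaleR_sum_right)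
qed

lemma bounded_linear_matrix_vector_mult:
  fixes A :: "complex ^ 'n::finite ^ 'm::finite"
  shows "bounded_linear (\<lambda>x. A *v x)"
  by (simp add: linear_matrix_vector_mult flip: linear_conv_bounded_linear)

lemma block_opnorm_nonneg: "0 \<le> block_opnorm B"
  unfolding block_opnorm_def by (rule onorm_pos_le[OF bounded_linear_matrix_vector_mult])

lemma block_opnorm_scaleR: "block_opnorm (r *\<^sub>R B) = \<bar>r\<bar> * block_opnorm B"
proof -
  have "(\<lambda>x. stack (r *\<^sub>R B) *v x) = (\<lambda>x. r *\<^sub>R (stack B *v x))"
    by (simp add: fun_eq_iff vec_eq_iff stack_def matrix_vector_mult_def scaleR_sum_right)
  then show ?thesis
    unfolding block_opnorm_def
    using onorm_scaleR[OF bounded_linear_matrix_vector_mult] by simp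
qed

lemma norm_entry_le_block_opnorm:
  fixes B :: "complex ^ 'n::finite ^ 'm::finite ^ 'k::finite"
  shows "norm (B $ k $ i $ j) \<le> block_opnorm B"
proof -
  have "norm (B $ k $ i $ j) = norm ((stack B *v axis j 1) $ (k, i))"
    by (simp add: stack_def matrix_vector_mult_def axis_def if_distrib[of "(*) _"] cong: if_cong)
  also have "\<dots> \<le> norm (stack B *v axis j 1)"
    by (rule Finite_Cartesian_Product.norm_nth_le)
  also have "\<dots> \<le> block_opnorm B * norm (axis j (1::complex) :: complex ^ 'n)"
    unfolding block_opnorm_def by (rule onorm[OF bounded_linear_matrix_vector_mult])
  also have "\<dots> = block_opnorm B"
    by simp
  finally show ?thesis .
qed

lemma norm_vec_le_sum: "norm (x :: 'a::real_normed_vector ^ 'n::finite) \<le> (\<Sum>i\<in>UNIV. norm (x $ i))"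
  by (simp add: norm_vec_def L2_set_le_sum)

lemma norm_le_block_opnorm:
  fixes B :: "complex ^ 'n::finite ^ 'm::finite ^ 'k::finite"
  shows "norm B \<le> real (CARD('k) * CARD('m) * CARD('n)) * block_opnorm B"
proof -
  have "norm B \<le> (\<Sum>k\<in>UNIV. \<Sum>i\<in>UNIV. \<Sum>j\<in>UNIV. norm (B $ k $ i $ j))"
    by (intro order_trans[OF norm_vec_le_sum] sum_mono order_refl)
  also have "\<dots> \<le> (\<Sum>k\<in>(UNIV::'k set). \<Sum>i\<in>(UNIV::'m set). \<Sum>j\<in>(UNIV::'n set). block_opnorm B)"
    by (intro sum_mono norm_entry_le_block_opnorm)
  finally show ?thesis
    by simp
qed

section \<open>Hermitian matrices and the Poincare inequality\<close>

lemma subspace_hermitian_matrices: "subspace (hermitian_matrices :: (complex ^ 'n::finite ^ 'n) set)"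
  by (auto simp: subspace_def hermitian_matrices_def conj_transpose_def vec_eq_iff)

lemma mat_of_real_hermitian: "mat (of_real r) \<in> hermitian_matrices"
  by (simp add: hermitian_matrices_def conj_transpose_def vec_eq_iff mat_def)

lemma linear_trace: "linear (trace :: complex ^ 'n::finite ^ 'n \<Rightarrow> complex)"
  by (auto intro!: linearI simp: trace_def sum.distrib scaleR_sum_right)

lemma trace_hermitian_real:
  assumes "A \<in> hermitian_matrices"
  shows "trace A \<in> \<real>"
  using trace_mult_hermitian_real[OF assms mat_of_real_hermitian[of 1]] by simp

lemma linear_gradient: "linear (gradient L)"
proof (rule linearI)
  show "gradient L (X + Y) = gradient L X + gradient L Y" for X Y
    by (simp add: vec_eq_iff gradient_def matrix_matrix_mult_def algebra_simps sum.distrib)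
  show "gradient L (r *\<^sub>R X) = r *\<^sub>R gradient L X" for r X
    by (simp add: vec_eq_iff gradient_def matrix_matrix_mult_def scaleR_sum_right scaleR_diff_right)
qed

lemma mat_mult_entry: "(mat c ** A) $ i $ j = c * A $ i $ j" for A :: "complex ^ 'n::finite ^ 'n"
  by (simp add: matrix_matrix_mult_def mat_def if_distrib[of "\<lambda>x. x * _"] cong: if_cong)

lemma mult_mat_entry: "(A ** mat c) $ i $ j = A $ i $ j * c" for A :: "complex ^ 'n::finite ^ 'n"
  by (simp add: matrix_matrix_mult_def mat_def if_distrib[of "(*) _"] cong: if_cong)

lemma gradient_mat: "gradient L (mat c) = 0"
  by (simp add: vec_eq_iff gradient_def mat_mult_entry mult_mat_entry)

text \<open>
  Injectivity of a linear map on a finite-dimensional space bounds the norm of the argument by that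
  of the value, and all norms of the value are equivalent. The trace condition selects a complement
  of the scalars, on which the gradient is injective.
\<close>

lemma gradient_poincare:
  fixes L :: "complex ^ 'n::finite ^ 'n ^ 'N::finite"
  assumes ker: "\<forall>X \<in> hermitian_matrices. gradient L X = 0 \<longrightarrow> (\<exists>c. X = mat c)"
  obtains C where "0 \<le> C"
    and "\<And>f. f \<in> hermitian_matrices \<Longrightarrow> trace f = 0 \<Longrightarrow> norm f \<le> C * block_opnorm (gradient L f)"
proof -
  define V where "V = hermitian_matrices \<inter> {X :: complex ^ 'n ^ 'n. trace X = 0}"
  have sub: "subspace V"
    unfolding V_def
    by (intro subspace_inter subspace_hermitian_matrices linear_subspace_kernel linear_trace)
  have "\<forall>X\<in>V. gradient L X = 0 \<longrightarrow> X = 0"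
  proof (intro ballI impI)
    fix X assume X: "X \<in> V" "gradient L X = 0"
    then obtain c where c: "X = mat c"
      using ker by (auto simp: V_def)
    have "of_nat CARD('n) * c = 0"
      using X by (simp add: V_def c trace_def mat_def)
    then show "X = 0"
      by (simp add: c)
  qed
  moreover have "bounded_linear (gradient L)"
    by (simp add: linear_gradient flip: linear_conv_bounded_linear)
  ultimately obtain e where e: "e > 0" "\<forall>X\<in>V. norm (gradient L X) \<ge> e * norm X"
    using injective_imp_isometric[OF closed_subspace[OF sub] sub] by blast
  define K where "K = real (CARD('N) * CARD('n) * CARD('n))"
  show thesis
  proof
    show "0 \<le> K / e"
      using e by (simp add: K_def)
    fix f :: "complex ^ 'n ^ 'n"
    assume "f \<in> hermitian_matrices" "trace f = 0"
    then have "e * norm f \<le> norm (gradient L f)"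
      using e by (simp add: V_def)
    also have "\<dots> \<le> K * block_opnorm (gradient L f)"
      unfolding K_def by (rule norm_le_block_opnorm)
    finally show "norm f \<le> K / e * block_opnorm (gradient L f)"
      using e by (simp add: field_simps)
  qed
qed

section \<open>The trace pairing\<close>

lemma linear_trace_mult_left: "linear (\<lambda>f. trace (f ** D))" for D :: "complex ^ 'n::finite ^ 'n"
proof (rule linearI)
  show "trace ((f + g) ** D) = trace (f ** D) + trace (g ** D)" for f g
    by (simp add: trace_def matrix_matrix_mult_def algebra_simps sum.distrib)
  show "trace ((r *\<^sub>R f) ** D) = r *\<^sub>R trace (f ** D)" for r f
    by (simp add: trace_def matrix_matrix_mult_def scaleR_sum_right)
qed

lemma trace_mult_diff: "trace (f ** (A - B)) = trace (f ** A) - trace (f ** B)"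
  for A :: "complex ^ 'n::finite ^ 'n"
  by (simp add: trace_def matrix_matrix_mult_def algebra_simps sum_subtractf)

lemma trace_mat_mult: "trace (mat c ** A) = c * trace A" for A :: "complex ^ 'n::finite ^ 'n"
  by (simp add: trace_def mat_mult_entry sum_distrib_left)

lemma trace_hermitian_square:
  assumes "D \<in> hermitian_matrices"
  shows "Re (trace (D ** D)) = (\<Sum>i\<in>UNIV. \<Sum>j\<in>UNIV. (cmod (D $ i $ j))\<^sup>2)"
proof -
  have "trace (D ** D) = trace (D ** conj_transpose D)"
    using assms by (simp add: hermitian_matrices_def)
  also have "\<dots> = (\<Sum>i\<in>UNIV. \<Sum>j\<in>UNIV. D $ i $ j * cnj (D $ i $ j))"
    by (simp add: trace_def matrix_matrix_mult_def conj_transpose_def)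
  finally show ?thesis
    by (simp only: complex_norm_square[symmetric] Re_sum Re_complex_of_real)
qed

lemma trace_hermitian_square_pos:
  assumes "D \<in> hermitian_matrices" and "D \<noteq> 0"
  shows "0 < Re (trace (D ** D))"
proof -
  obtain i j where ij: "D $ i $ j \<noteq> 0"
    using assms(2) by (auto simp: vec_eq_iff)
  then have row: "0 < (\<Sum>j\<in>UNIV. (cmod (D $ i $ j))\<^sup>2)"
    by (intro sum_pos2[of UNIV j]) auto
  show ?thesis
    unfolding trace_hermitian_square[OF assms(1)]
    by (rule sum_pos2[of UNIV i]) (simp_all add: row sum_nonneg)
qed

section \<open>The Wasserstein distance\<close>

lemma W1_upper:
  assumes "f \<in> hermitian_matrices" and "block_opnorm (gradient L f) \<le> 1"
  shows "ereal (Re (trace (f ** (\<rho>\<^sub>0 - \<rho>\<^sub>1)))) \<le> W1 L \<rho>\<^sub>0 \<rho>\<^sub>1"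
  unfolding W1_def using assms by (intro SUP_upper) auto

lemma W1_least:
  assumes "\<And>f. f \<in> hermitian_matrices \<Longrightarrow> block_opnorm (gradient L f) \<le> 1 \<Longrightarrow>
    ereal (Re (trace (f ** (\<rho>\<^sub>0 - \<rho>\<^sub>1)))) \<le> b"
  shows "W1 L \<rho>\<^sub>0 \<rho>\<^sub>1 \<le> b"
  unfolding W1_def using assms by (intro SUP_least) auto

lemma W1_nonneg: "0 \<le> W1 L \<rho>\<^sub>0 \<rho>\<^sub>1"
  using W1_upper[of 0 L \<rho>\<^sub>0 \<rho>\<^sub>1] block_opnorm_scaleR[of 0 "gradient L 0"]
    subspace_0[OF subspace_hermitian_matrices] linear_0[OF linear_gradient, of L]
    linear_0[OF linear_trace_mult_left, of "\<rho>\<^sub>0 - \<rho>\<^sub>1"]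
  by (simp add: zero_ereal_def)

lemma W1_self: "W1 L \<rho> \<rho> = 0"
proof (rule antisym[OF W1_least W1_nonneg])
  show "ereal (Re (trace (f ** (\<rho> - \<rho>)))) \<le> 0" for f
    unfolding trace_mult_diff by simp
qed

text \<open>The feasible potentials are stable under \<open>f \<mapsto> - f\<close>, which exchanges the two arguments.\<close>

lemma W1_commute: "W1 L \<rho>\<^sub>0 \<rho>\<^sub>1 = W1 L \<rho>\<^sub>1 \<rho>\<^sub>0"
proof -
  have le: "W1 L A B \<le> W1 L B A" for A B
  proof (rule W1_least)
    fix f assume f: "f \<in> hermitian_matrices" "block_opnorm (gradient L f) \<le> 1"
    have "trace (f ** (A - B)) = trace (- f ** (B - A))"
      by (simp only: linear_neg[OF linear_trace_mult_left] trace_mult_diff) simp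
    moreover have "block_opnorm (gradient L (- f)) = block_opnorm (gradient L f)"
      using block_opnorm_scaleR[of "-1" "gradient L f"] by (simp add: linear_neg[OF linear_gradient])
    ultimately show "ereal (Re (trace (f ** (A - B)))) \<le> W1 L B A"
      using W1_upper[of "- f" L B A] f subspace_neg[OF subspace_hermitian_matrices f(1)] by simp
  qed
  show ?thesis
    by (rule antisym[OF le le])
qed

lemma W1_triangle: "W1 L \<rho>\<^sub>0 \<rho>\<^sub>2 \<le> W1 L \<rho>\<^sub>0 \<rho>\<^sub>1 + W1 L \<rho>\<^sub>1 \<rho>\<^sub>2"
proof (rule W1_least)
  fix f assume f: "f \<in> hermitian_matrices" "block_opnorm (gradient L f) \<le> 1"
  have "ereal (Re (trace (f ** (\<rho>\<^sub>0 - \<rho>\<^sub>2)))) =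
      ereal (Re (trace (f ** (\<rho>\<^sub>0 - \<rho>\<^sub>1)))) + ereal (Re (trace (f ** (\<rho>\<^sub>1 - \<rho>\<^sub>2))))"
    by (simp add: trace_mult_diff)
  also have "\<dots> \<le> W1 L \<rho>\<^sub>0 \<rho>\<^sub>1 + W1 L \<rho>\<^sub>1 \<rho>\<^sub>2"
    by (intro add_mono W1_upper f)
  finally show "ereal (Re (trace (f ** (\<rho>\<^sub>0 - \<rho>\<^sub>2)))) \<le> W1 L \<rho>\<^sub>0 \<rho>\<^sub>1 + W1 L \<rho>\<^sub>1 \<rho>\<^sub>2" .
qed

text \<open>
  Subtracting from a feasible potential its mean value, the scalar matrix with the same trace,
  changes neither the gradient nor the pairing with a traceless matrix. What remains is bounded by
  the Poincare inequality, and the pairing is continuous.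
\<close>

lemma W1_finite:
  fixes L :: "complex ^ 'n::finite ^ 'n ^ 'N::finite"
  assumes ker: "\<forall>X \<in> hermitian_matrices. gradient L X = 0 \<longrightarrow> (\<exists>c. X = mat c)"
    and tr: "trace \<rho>\<^sub>0 = trace \<rho>\<^sub>1"
  shows "\<bar>W1 L \<rho>\<^sub>0 \<rho>\<^sub>1\<bar> \<noteq> \<infinity>"
proof -
  define D where "D = \<rho>\<^sub>0 - \<rho>\<^sub>1"
  have D: "trace D = 0"
    using tr by (simp add: D_def linear_diff[OF linear_trace])
  obtain C where C: "0 \<le> C"
    "\<And>f. f \<in> hermitian_matrices \<Longrightarrow> trace f = 0 \<Longrightarrow> norm f \<le> C * block_opnorm (gradient L f)"
    using gradient_poincare[OF ker] by blast
  have "bounded_linear (\<lambda>f. trace (f ** D))"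
    by (simp add: linear_trace_mult_left flip: linear_conv_bounded_linear)
  then obtain K where K: "0 \<le> K" "\<And>f. norm (trace (f ** D)) \<le> norm f * K"
    using bounded_linear.nonneg_bounded by blast
  have "W1 L \<rho>\<^sub>0 \<rho>\<^sub>1 \<le> ereal (C * K)"
  proof (rule W1_least)
    fix f assume f: "f \<in> hermitian_matrices" "block_opnorm (gradient L f) \<le> 1"
    define r where "r = Re (trace f) / real CARD('n)"
    define g where "g = f - mat (of_real r)"
    have "trace (mat (of_real r) :: complex ^ 'n ^ 'n) = of_real (Re (trace f))"
      by (simp add: trace_def mat_def r_def)
    then have "trace g = 0"
      using trace_hermitian_real[OF f(1)] by (simp add: g_def linear_diff[OF linear_trace])
    moreover have "g \<in> hermitian_matrices"
      unfolding g_def using f mat_of_real_hermitian subspace_diff[OF subspace_hermitian_matrices] by blast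
    moreover have "gradient L g = gradient L f"
      by (simp add: g_def linear_diff[OF linear_gradient] gradient_mat)
    ultimately have "norm g \<le> C * block_opnorm (gradient L f)"
      using C(2)[of g] by simp
    also have "\<dots> \<le> C"
      using f C(1) by (simp add: mult_left_le)
    finally have "norm g \<le> C" .
    then have "norm g * K \<le> C * K"
      using K(1) by (rule mult_right_mono)
    moreover have "trace (f ** D) = trace (g ** D)"
      by (simp add: g_def linear_diff[OF linear_trace_mult_left] trace_mat_mult D)
    ultimately show "ereal (Re (trace (f ** (\<rho>\<^sub>0 - \<rho>\<^sub>1)))) \<le> ereal (C * K)"
      using K(2)[of g] complex_Re_le_cmod[of "trace (g ** D)"] by (simp add: D_def)
  qed
  then show ?thesis
    using W1_nonneg[of L \<rho>\<^sub>0 \<rho>\<^sub>1] by auto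
qed

lemma W1_pos:
  assumes "\<rho>\<^sub>0 \<in> hermitian_matrices" and "\<rho>\<^sub>1 \<in> hermitian_matrices" and "\<rho>\<^sub>0 \<noteq> \<rho>\<^sub>1"
  shows "0 < W1 L \<rho>\<^sub>0 \<rho>\<^sub>1"
proof -
  define D where "D = \<rho>\<^sub>0 - \<rho>\<^sub>1"
  have D: "D \<in> hermitian_matrices" "D \<noteq> 0"
    using assms subspace_diff[OF subspace_hermitian_matrices] by (auto simp: D_def)
  \<comment> \<open>The summand \<open>1\<close> keeps the scaling defined when the gradient of \<open>D\<close> vanishes.\<close>
  define c where "c = 1 / (1 + block_opnorm (gradient L D))"
  have c: "0 < c" "c * block_opnorm (gradient L D) \<le> 1"
    using block_opnorm_nonneg[of "gradient L D"] by (auto simp: c_def field_simps)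
  have "0 < c * Re (trace (D ** D))"
    using c D by (simp add: trace_hermitian_square_pos)
  also have "\<dots> = Re (trace ((c *\<^sub>R D) ** (\<rho>\<^sub>0 - \<rho>\<^sub>1)))"
    by (simp add: linear_cmul[OF linear_trace_mult_left] D_def)
  finally have "0 < ereal (Re (trace ((c *\<^sub>R D) ** (\<rho>\<^sub>0 - \<rho>\<^sub>1))))"
    by simp
  also have "\<dots> \<le> W1 L \<rho>\<^sub>0 \<rho>\<^sub>1"
    using c D subspace_scale[OF subspace_hermitian_matrices]
    by (intro W1_upper) (auto simp: linear_cmul[OF linear_gradient] block_opnorm_scaleR)
  finally show ?thesis .
qed

theorem theorem2:
  fixes L :: "complex ^ 'n::finite ^ 'n ^ 'N::finite"
  assumes "\<forall>k. L $ k \<in> hermitian_matrices"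
    and "\<forall>X \<in> hermitian_matrices. gradient L X = 0 \<longrightarrow> (\<exists>c. X = mat c)"
  shows "(\<forall>\<rho>\<^sub>0 \<in> density_matrices. \<forall>\<rho>\<^sub>1 \<in> density_matrices. \<bar>W1 L \<rho>\<^sub>0 \<rho>\<^sub>1\<bar> \<noteq> \<infinity>) \<and>
    Metric_space density_matrices (\<lambda>\<rho>\<^sub>0 \<rho>\<^sub>1. real_of_ereal (W1 L \<rho>\<^sub>0 \<rho>\<^sub>1))"
proof -
  have fin: "\<bar>W1 L A B\<bar> \<noteq> \<infinity>" if "A \<in> density_matrices" "B \<in> density_matrices" for A B
    using W1_finite[OF assms(2)] that by (simp add: density_matrices_def)
  have herm: "A \<in> hermitian_matrices" if "A \<in> density_matrices" for A :: "complex ^ 'n ^ 'n"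
    using that by (simp add: density_matrices_def psd_matrices_def)
  have "Metric_space density_matrices (\<lambda>A B. real_of_ereal (W1 L A B))"
  proof
    show "0 \<le> real_of_ereal (W1 L A B)" for A B
      by (rule real_of_ereal_pos[OF W1_nonneg])
    show "real_of_ereal (W1 L A B) = real_of_ereal (W1 L B A)" for A B
      by (simp add: W1_commute)
    fix A B :: "complex ^ 'n ^ 'n"
    assume A: "A \<in> density_matrices" and B: "B \<in> density_matrices"
    show "real_of_ereal (W1 L A B) = 0 \<longleftrightarrow> A = B"
      using W1_pos[OF herm[OF A] herm[OF B], of L] fin[OF A B]
      by (cases "A = B") (auto simp: W1_self real_of_ereal_eq_0)
    fix C :: "complex ^ 'n ^ 'n"
    assume C: "C \<in> density_matrices"
    show "real_of_ereal (W1 L A C) \<le> real_of_ereal (W1 L A B) + real_of_ereal (W1 L B C)"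
      using W1_triangle[of L A C B] fin[OF A B] fin[OF B C] fin[OF A C]
      by (cases "W1 L A B"; cases "W1 L B C"; cases "W1 L A C") auto
  qed
  then show ?thesis
    by (intro conjI ballI fin)
qed

end
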